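(* Let $T$ be a tree on $n\ge1$ vertices, and put $h(n)=\lfloor (n-1)/3\rfloor$ and $r(n)=n-h(n)$. There exists a placement of $r(n)$ labelled tokens (leaving $h(n)$ holes) on $T$ for which there is a finite closed schedule, starting at this placement, whose contact graph contains a Hamilton path.
   Context: Let $G$ be a finite graph. A placement of $r$ labelled tokens on $G$ assigns the labelled tokens injectively to vertices of $G$; the $|V(G)|-r$ unoccupied vertices are called holes. A token slide moves one labelled token along an edge into an adjacent hole. A finite sequence of slides (possibly empty) is a closed schedule if every labelled token returns to its initial vertex. The recorded placements of a schedule are placements occurring along it (including the initial one). Two labelled tokens are in contact at a recorded placement when they occupy adjacent vertices of $G$. The contact graph of a schedule has the token labels as vertices and the recorded contacts as edges. *)

theory Defs
  imports "Graph_Theory.Graph_Theory"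
begin

text \<open>
  Finite simple graphs are \<^locale>\<open>pair_graph\<close>s: every undirected edge is represented by both of
  its arcs. The constant \<^const>\<open>tree\<close> of the library cannot be used for them, because it counts
  the back-and-forth walk along an edge as a cycle; cycles of a simple graph have at least three
  edges. Connectedness includes that the vertex set is nonempty.
\<close>
definition tree_graph :: "'a pair_pre_digraph \<Rightarrow> bool" where
  "tree_graph G \<longleftrightarrow>
     pair_graph G \<and> connected (with_proj G) \<and>
     \<not> (\<exists>c. pre_digraph.cycle (with_proj G) c \<and> length c \<ge> 3)"

text \<open>
  The labels of \<open>r\<close> tokens are the numbers below \<open>r\<close>. A placement is a function from labels to
  vertices, whose values at numbers that are not labels are irrelevant.
\<close>
definition placement :: "'a pair_pre_digraph \<Rightarrow> nat \<Rightarrow> (nat \<Rightarrow> 'a) \<Rightarrow> bool" where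
  "placement G r p \<longleftrightarrow> inj_on p {..<r} \<and> p ` {..<r} \<subseteq> pverts G"

definition holes :: "'a pair_pre_digraph \<Rightarrow> nat \<Rightarrow> (nat \<Rightarrow> 'a) \<Rightarrow> 'a set" where
  "holes G r p = pverts G - p ` {..<r}"

definition slide :: "'a pair_pre_digraph \<Rightarrow> nat \<Rightarrow> (nat \<Rightarrow> 'a) \<Rightarrow> (nat \<Rightarrow> 'a) \<Rightarrow> bool" where
  "slide G r p q \<longleftrightarrow> (\<exists>i<r. \<exists>v \<in> holes G r p. (p i, v) \<in> parcs G \<and> q = p(i := v))"

text \<open>
  A schedule is given by the nonempty list of its recorded placements; a list of length one is the
  empty sequence of slides.
\<close>
definition schedule :: "'a pair_pre_digraph \<Rightarrow> nat \<Rightarrow> (nat \<Rightarrow> 'a) list \<Rightarrow> bool" where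
  "schedule G r ps \<longleftrightarrow> ps \<noteq> [] \<and> placement G r (hd ps) \<and> successively (slide G r) ps"

definition closed_schedule :: "'a pair_pre_digraph \<Rightarrow> nat \<Rightarrow> (nat \<Rightarrow> 'a) list \<Rightarrow> bool" where
  "closed_schedule G r ps \<longleftrightarrow> schedule G r ps \<and> (\<forall>i<r. last ps i = hd ps i)"

definition contact :: "'a pair_pre_digraph \<Rightarrow> (nat \<Rightarrow> 'a) \<Rightarrow> nat \<Rightarrow> nat \<Rightarrow> bool" where
  "contact G p i j \<longleftrightarrow> i \<noteq> j \<and> (p i, p j) \<in> parcs G"

definition contact_graph ::
    "'a pair_pre_digraph \<Rightarrow> nat \<Rightarrow> (nat \<Rightarrow> 'a) list \<Rightarrow> nat pair_pre_digraph" where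
  "contact_graph G r ps =
     \<lparr> pverts = {..<r}, parcs = {(i, j). i < r \<and> j < r \<and> (\<exists>p \<in> set ps. contact G p i j)} \<rparr>"

definition hamilton_path :: "'a pair_pre_digraph \<Rightarrow> 'a list \<Rightarrow> bool" where
  "hamilton_path G xs \<longleftrightarrow> vpath xs (with_proj G) \<and> set xs = pverts G"

definition hole_number :: "nat \<Rightarrow> nat" where
  "hole_number n = (n - 1) div 3"

definition token_number :: "nat \<Rightarrow> nat" where
  "token_number n = n - hole_number n"

end

theory Submission
  imports Defs
begin

text \<open>
  A schedule followed by its own reversal is closed and records the same contacts. Hence one closed
  schedule records every contact that is possible in some placement reachable from the initial one
  (\<open>closed_schedule_of_meetings\<close>), and it suffices to list all tokens in such a way that any two
  consecutive ones can be brought into contact (\<open>can_meet\<close>). Let \<open>h\<close> be the number of holes, so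
  that \<open>n \<le> 3 * h + 3\<close>.

  If the graph has a path with \<open>n - h\<close> vertices, put the tokens on it and never move. Otherwise a
  longest path has at most \<open>2 * h + 2\<close> vertices, and then every vertex lies within distance \<open>h\<close> of
  the middle edge \<open>{c, c'}\<close> of this path (\<open>central_edge\<close>): a branch leaving the path at one of
  its vertices is no longer than either of the two parts of the path at that vertex, since it
  could replace them. This is the only place where the number 3 matters.

  In the second case keep the \<open>h\<close> holes connected and let them travel through the graph. A token
  next to a connected set of holes can glide through it, so any two tokens next to it can meet
  (\<open>can_meet_if_adjacent\<close>). The holes travel in depth-first order along a breadth-first spanning
  tree grown from the central edge. To enter a new vertex \<open>y\<close>, the token on \<open>y\<close> glides through the
  holes to the far end \<open>x\<close> of a branch that has been explored already. The holes have to keep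
  only the ancestors of \<open>y\<close> on its side of the central edge, as only these may still have children
  to be entered. When \<open>y\<close> is closer than \<open>h\<close> to the central edge, there are fewer than \<open>h\<close> such
  ancestors, so a suitable \<open>x\<close> exists (\<open>sweeping_step\<close>). Vertices at distance \<open>h\<close> are never entered; their tokens are next to the
  holes as soon as the holes reach their parents.

  The Hamilton path begins with the tokens at distance \<open>h\<close> that are next to the initial holes. Then
  come the displaced tokens in the order of their displacement, each followed by the tokens at
  distance \<open>h\<close> whose parent it has vacated. Consecutive tokens in it meet
  because they are at some moment next to the same set of holes (\<open>progress_step\<close>).
\<close>

section \<open>Slides and possible contacts\<close>

lemma successively_if_pairwise:
  assumes "distinct xs" "\<And>x y. x \<in> set xs \<Longrightarrow> y \<in> set xs \<Longrightarrow> x \<noteq> y \<Longrightarrow> P x y"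
  shows "successively P xs"
  using assms by (induction xs rule: induct_list012) auto

locale connected_pair_graph = pair_graph G for G :: "'a pair_pre_digraph" +
  assumes connected: "connected (with_proj G)"
begin

lemma arc_in_verts: "(u, v) \<in> parcs G \<Longrightarrow> u \<in> pverts G \<and> v \<in> pverts G"
  using arc_fst_in_verts arc_snd_in_verts by force

lemma arc_sym: "(u, v) \<in> parcs G \<Longrightarrow> (v, u) \<in> parcs G"
  using pair_sym_arcs by (auto simp: symmetric_def arcs_ends_conv elim: symE)

lemma arc_neq: "(u, v) \<in> parcs G \<Longrightarrow> u \<noteq> v"
  using pair_no_loops by force

lemma verts_nonempty: "pverts G \<noteq> {}"
  using connected by (auto simp: connected_def strongly_connected_def mk_symmetric_def)

lemma verts_connected:
  assumes "u \<in> pverts G" "v \<in> pverts G"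
  shows "(u, v) \<in> (parcs G)\<^sup>*"
proof -
  have "u \<rightarrow>\<^sup>*\<^bsub>with_proj (mk_symmetric (with_proj G))\<^esub> v"
    using connected assms by (auto simp: connected_def strongly_connected_def mk_symmetric_def)
  then have "(u, v) \<in> (arcs_ends (with_proj (mk_symmetric (with_proj G))))\<^sup>*"
    by (rule reachable_rtranclI)
  moreover have "arcs_ends (with_proj (mk_symmetric (with_proj G))) \<subseteq> parcs G"
    by (auto simp: mk_symmetric_def arc_sym)
  ultimately show ?thesis using rtrancl_mono by blast
qed

lemma placement_update:
  assumes "placement G r p" "i < r" "x \<in> insert (p i) (holes G r p)"
  shows "placement G r (p(i := x))"
    and "holes G r (p(i := x)) = insert (p i) (holes G r p) - {x}"
proof -
  have inj: "inj_on p {..<r}" and sub: "p ` {..<r} \<subseteq> pverts G"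
    using assms(1) by (auto simp: placement_def)
  have oth: "p j \<noteq> p i" if "j < r" "j \<noteq> i" for j
    using inj that assms(2) by (auto simp: inj_on_def)
  have x: "x \<in> pverts G" "\<And>j. j < r \<Longrightarrow> j \<noteq> i \<Longrightarrow> p j \<noteq> x"
    using assms(2,3) sub oth by (auto simp: holes_def)
  show "placement G r (p(i := x))"
    unfolding placement_def using inj sub x by (auto simp: inj_on_def)
  show "holes G r (p(i := x)) = insert (p i) (holes G r p) - {x}"
    unfolding holes_def using x oth sub assms(2)
    by (auto simp: image_iff split: if_splits; blast)
qed

lemma slide_placement: "placement G r p \<Longrightarrow> slide G r p q \<Longrightarrow> placement G r q"
  by (auto simp: slide_def intro: placement_update(1))

lemma slides_placement: "(slide G r)\<^sup>*\<^sup>* p q \<Longrightarrow> placement G r p \<Longrightarrow> placement G r q"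
  by (induction rule: rtranclp_induct) (auto intro: slide_placement)

lemma slide_sym:
  assumes "placement G r p" "slide G r p q"
  shows "slide G r q p"
proof -
  obtain i v where iv: "i < r" "v \<in> holes G r p" "(p i, v) \<in> parcs G" "q = p(i := v)"
    using assms(2) by (auto simp: slide_def)
  have "p i \<in> holes G r q"
    using iv arc_neq placement_update(2)[OF assms(1) iv(1), of v] by auto
  moreover have "(q i, p i) \<in> parcs G" "p = q(i := p i)" using iv arc_sym by auto
  ultimately show ?thesis using iv(1) unfolding slide_def by blast
qed

text \<open>
  A token may use its own vertex and the holes as a corridor: leaving its vertex turns it into a
  hole, so the corridor stays the same set while the token moves inside it.
\<close>
lemma glide:
  assumes "placement G r p" "i < r"
    and "(p i, x) \<in> (Restr (parcs G) (insert (p i) (holes G r p)))\<^sup>*"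
  shows "x \<in> insert (p i) (holes G r p) \<and> (slide G r)\<^sup>*\<^sup>* p (p(i := x))"
  using assms(3)
proof (induction rule: rtrancl_induct)
  case base
  then show ?case by simp
next
  case (step x z)
  have "slide G r (p(i := x)) (p(i := z))" if "x \<noteq> z"
    unfolding slide_def
    using placement_update(2)[OF assms(1,2), of x] step assms(2) that
    by (intro exI[of _ i] conjI bexI[of _ z]) auto
  then show ?case using step
    by (metis IntE SigmaD2 rtranclp.rtrancl_into_rtrancl)
qed

definition can_meet :: "nat \<Rightarrow> (nat \<Rightarrow> 'a) \<Rightarrow> nat \<Rightarrow> nat \<Rightarrow> bool" where
  "can_meet r p i j \<longleftrightarrow> (\<exists>q. (slide G r)\<^sup>*\<^sup>* p q \<and> contact G q i j)"

lemma can_meet_by_glide: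
  assumes "placement G r p0" "(slide G r)\<^sup>*\<^sup>* p0 p" "i < r" "i \<noteq> j"
    and "(p i, w) \<in> (Restr (parcs G) (insert (p i) (holes G r p)))\<^sup>*" "(w, p j) \<in> parcs G"
  shows "can_meet r p0 i j"
proof -
  have "(slide G r)\<^sup>*\<^sup>* p (p(i := w))"
    using glide slides_placement assms by blast
  moreover have "contact G (p(i := w)) i j" using assms by (simp add: contact_def)
  ultimately show ?thesis unfolding can_meet_def using assms(2) by (meson rtranclp_trans)
qed

text \<open>
  Slides are reversible, so every reachable placement occurs on a round trip.
\<close>
lemma excursion:
  assumes "(slide G r)\<^sup>*\<^sup>* p q" "placement G r p"
  shows "\<exists>ps. ps \<noteq> [] \<and> hd ps = p \<and> last ps = p \<and> successively (slide G r) ps \<and> q \<in> set ps"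
  using assms
proof (induction rule: converse_rtranclp_induct)
  case base
  then show ?case by (intro exI[of _ "[q]"]) simp
next
  case (step p p')
  then obtain ps where ps: "ps \<noteq> []" "hd ps = p'" "last ps = p'"
      "successively (slide G r) ps" "q \<in> set ps"
    using slide_placement by blast
  then show ?case using step slide_sym
    by (intro exI[of _ "p # ps @ [p]"]) (auto simp: successively_Cons successively_append_iff)
qed

lemma tour:
  assumes "placement G r p" "finite Q" "\<And>q. q \<in> Q \<Longrightarrow> (slide G r)\<^sup>*\<^sup>* p q"
  shows "\<exists>ps. ps \<noteq> [] \<and> hd ps = p \<and> last ps = p \<and> successively (slide G r) ps \<and> Q \<subseteq> set ps"
  using assms(2,3)
proof (induction rule: finite_induct)
  case empty
  show ?case by (intro exI[of _ "[p]"]) simp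
next
  case (insert q Q)
  then obtain ps where ps: "ps \<noteq> []" "hd ps = p" "last ps = p"
      "successively (slide G r) ps" "Q \<subseteq> set ps" by auto
  obtain ps' where ps': "ps' \<noteq> []" "hd ps' = p" "last ps' = p"
      "successively (slide G r) ps'" "q \<in> set ps'"
    using excursion insert.prems assms(1) by blast
  obtain t where t: "ps' = p # t" using ps' by (cases ps') auto
  show ?case using ps ps' t
    by (intro exI[of _ "ps @ t"])
       (auto simp: successively_Cons successively_append_iff last_append)
qed

text \<open>
  Choosing a witness for each pair of tokens that can meet gives finitely many placements, and the
  concatenation of the round trips to them records all these contacts.
\<close>
lemma closed_schedule_of_meetings:
  assumes p: "placement G r p" and xs: "distinct xs" "set xs = {..<r}" "xs \<noteq> []"
    and meet: "successively (can_meet r p) xs"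
  shows "\<exists>ps. closed_schedule G r ps \<and> hd ps = p \<and> hamilton_path (contact_graph G r ps) xs"
proof -
  define w where "w i j = (SOME q. (slide G r)\<^sup>*\<^sup>* p q \<and> contact G q i j)" for i j
  have w: "(slide G r)\<^sup>*\<^sup>* p (w i j) \<and> contact G (w i j) i j" if "can_meet r p i j" for i j
    using that unfolding can_meet_def w_def by (rule someI_ex)
  define Q where "Q = (\<lambda>(i, j). w i j) ` {(i, j). i < r \<and> j < r \<and> can_meet r p i j}"
  have "finite {(i, j). i < r \<and> j < r \<and> can_meet r p i j}"
    by (rule finite_subset[of _ "{..<r} \<times> {..<r}"]) auto
  then have "finite Q" unfolding Q_def by blast
  moreover have "\<And>q. q \<in> Q \<Longrightarrow> (slide G r)\<^sup>*\<^sup>* p q" using w by (auto simp: Q_def)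
  ultimately obtain ps where ps: "ps \<noteq> []" "hd ps = p" "last ps = p"
      "successively (slide G r) ps" "Q \<subseteq> set ps"
    using tour[OF p] by blast
  have met: "\<exists>q\<in>set ps. contact G q i j" if "i < r" "j < r" "can_meet r p i j" for i j
    using that ps(5) w[OF that(3)] unfolding Q_def by blast
  have walk: "set (vwalk_arcs ys) \<subseteq> parcs (contact_graph G r ps)"
    if "successively (can_meet r p) ys" "set ys \<subseteq> {..<r}" for ys
    using that
    by (induction ys rule: vwalk_arcs.induct) (auto simp: contact_graph_def met)
  have "hamilton_path (contact_graph G r ps) xs"
    unfolding hamilton_path_def vpath_def vwalk_def
    using walk[OF meet] xs by (simp add: contact_graph_def)
  then show ?thesis using ps p by (auto simp: closed_schedule_def schedule_def)
qed

section \<open>Distances and the middle of a longest path\<close>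


text \<open>
  The distance from a set \<open>R\<close> and the parent map of a breadth-first search started at \<open>R\<close>.
\<close>
lemma level_function:
  assumes "R \<subseteq> pverts G" "R \<noteq> {}"
  obtains lev :: "'a \<Rightarrow> nat" and par where
    "\<And>v. v \<in> pverts G \<Longrightarrow> lev v = 0 \<longleftrightarrow> v \<in> R"
    "\<And>v. v \<in> pverts G \<Longrightarrow> lev v > 0 \<Longrightarrow> (par v, v) \<in> parcs G \<and> lev v = Suc (lev (par v))"
    "\<And>u v. (u, v) \<in> parcs G \<Longrightarrow> lev v \<le> Suc (lev u)"
proof -
  define reach where "reach v k \<longleftrightarrow> (\<exists>u\<in>R. (u, v) \<in> parcs G ^^ k)" for v k
  define lev where "lev v = (LEAST k. reach v k)" for v
  have ex: "\<exists>k. reach v k" if "v \<in> pverts G" for v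
    using assms that verts_connected unfolding reach_def
    by (meson all_not_in_conv rtrancl_imp_relpow subsetD)
  then have lev: "reach v (lev v)" if "v \<in> pverts G" for v
    using that unfolding lev_def by (metis LeastI)
  have least: "lev v \<le> k" if "reach v k" for v k
    using that unfolding lev_def by (rule Least_le)
  have lip: "lev v \<le> Suc (lev u)" if "(u, v) \<in> parcs G" for u v
  proof -
    have "reach u (lev u)" using lev arc_in_verts that by blast
    then have "reach v (Suc (lev u))" using that unfolding reach_def by auto
    then show ?thesis by (rule least)
  qed
  have zero: "lev v = 0 \<longleftrightarrow> v \<in> R" if "v \<in> pverts G" for v
    using lev[OF that] least[of v 0] by (auto simp: reach_def)
  have "\<exists>u. (u, v) \<in> parcs G \<and> lev v = Suc (lev u)" if v: "v \<in> pverts G" "lev v > 0" for v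
  proof -
    obtain k where k: "lev v = Suc k" using v(2) gr0_implies_Suc by blast
    then obtain u where u: "(u, v) \<in> parcs G" "reach u k"
      using lev[OF v(1)] unfolding reach_def by auto
    then show ?thesis using k least[of u k] lip[of u v] by (intro exI[of _ u]) auto
  qed
  then obtain par where "\<And>v. v \<in> pverts G \<Longrightarrow> lev v > 0 \<Longrightarrow> (par v, v) \<in> parcs G \<and> lev v = Suc (lev (par v))"
    by metis
  then show ?thesis using that zero lip by blast
qed

definition is_path :: "'a list \<Rightarrow> bool" where
  "is_path xs \<longleftrightarrow> distinct xs \<and> set xs \<subseteq> pverts G \<and> successively (\<lambda>u v. (u, v) \<in> parcs G) xs"

lemma is_path_rev: "is_path (rev xs) \<longleftrightarrow> is_path xs"
  by (auto simp: is_path_def arc_sym elim!: successively_mono)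

lemma is_path_append:
  "is_path (xs @ ys) \<longleftrightarrow> is_path xs \<and> is_path ys \<and> set xs \<inter> set ys = {} \<and>
     (xs = [] \<or> ys = [] \<or> (last xs, hd ys) \<in> parcs G)"
  by (auto simp: is_path_def successively_append_iff)

text \<open>
  Let \<open>v\<close> be at distance \<open>k\<close> from the longest path, and let a shortest connection reach the path at
  its vertex number \<open>j\<close>. Combined with either part of the path, this connection is again a path,
  so by maximality \<open>k\<close> is at most the number of vertices on each side of position \<open>j\<close>. Going
  from \<open>v\<close> to the path and then along it to the nearer end of the middle edge therefore takes no
  more steps than going there from an end of the path, which is at most \<open>h\<close>.
\<close>
lemma central_edge:
  assumes xs: "is_path xs" "length xs \<ge> 2" "length xs \<le> 2 * h + 2"
    and longest: "\<And>ys. is_path ys \<Longrightarrow> length ys \<le> length xs"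
  obtains c c' and lev :: "'a \<Rightarrow> nat" and par where "(c, c') \<in> parcs G"
    "\<And>v. v \<in> pverts G \<Longrightarrow> lev v = 0 \<longleftrightarrow> v \<in> {c, c'}"
    "\<And>v. v \<in> pverts G \<Longrightarrow> lev v > 0 \<Longrightarrow> (par v, v) \<in> parcs G \<and> lev v = Suc (lev (par v))"
    "\<And>v. v \<in> pverts G \<Longrightarrow> lev v \<le> h"
proof -
  define L where "L = length xs"
  define m where "m = L div 2 - 1"
  have m: "Suc m < L" "m \<le> h" "L - m \<le> h + 2" using xs by (auto simp: m_def L_def)
  have arcs: "(xs ! j, xs ! Suc j) \<in> parcs G" if "Suc j < L" for j
    using xs(1) that unfolding is_path_def L_def
    by (simp add: successively_conv_nth)
  have inV: "set xs \<subseteq> pverts G" using xs(1) by (simp add: is_path_def)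
  have ne: "set xs \<noteq> {}" using xs(2) by auto
  define c where "c = xs ! m"
  define c' where "c' = xs ! Suc m"
  have cc: "(c, c') \<in> parcs G" using arcs m by (simp add: c_def c'_def)
  obtain lev :: "'a \<Rightarrow> nat" and par where lev:
    "\<And>v. v \<in> pverts G \<Longrightarrow> lev v = 0 \<longleftrightarrow> v \<in> {c, c'}"
    "\<And>v. v \<in> pverts G \<Longrightarrow> lev v > 0 \<Longrightarrow> (par v, v) \<in> parcs G \<and> lev v = Suc (lev (par v))"
    "\<And>u v. (u, v) \<in> parcs G \<Longrightarrow> lev v \<le> Suc (lev u)"
    using level_function[of "{c, c'}"] arc_in_verts[OF cc] by auto
  obtain dist :: "'a \<Rightarrow> nat" and up where dist:
    "\<And>v. v \<in> pverts G \<Longrightarrow> dist v = 0 \<longleftrightarrow> v \<in> set xs"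
    "\<And>v. v \<in> pverts G \<Longrightarrow> dist v > 0 \<Longrightarrow> (up v, v) \<in> parcs G \<and> dist v = Suc (dist (up v))"
    using level_function[OF inV] ne by metis
  \<comment> \<open>The path itself bounds the distance of its vertices from the middle edge.\<close>
  have left: "lev (xs ! (m - k)) \<le> k" if "k \<le> m" for k
    using that
  proof (induction k)
    case 0
    then show ?case using lev(1) cc arc_in_verts by (auto simp: c_def)
  next
    case (Suc k)
    have "(xs ! (m - Suc k), xs ! (m - k)) \<in> parcs G"
      using arcs[of "m - Suc k"] Suc.prems m by (simp add: Suc_diff_Suc)
    then show ?case using lev(3)[OF arc_sym] Suc by fastforce
  qed
  have right: "lev (xs ! (Suc m + k)) \<le> k" if "Suc m + k < L" for k
    using that
  proof (induction k)
    case 0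
    then show ?case using lev(1) cc arc_in_verts by (auto simp: c'_def)
  next
    case (Suc k)
    then show ?case using lev(3)[OF arcs[of "Suc m + k"]] by fastforce
  qed
  \<comment> \<open>\<open>ys\<close> leads from \<open>v\<close> down to the path, excluding its end \<open>xs ! j\<close>. The bounds on \<open>dist\<close>
     keep it simple and disjoint from the path.\<close>
  have tail: "\<exists>j ys. j < L \<and> is_path ys \<and> (ys = [] \<or> (last ys, xs ! j) \<in> parcs G) \<and>
      (ys = [] \<longrightarrow> v = xs ! j) \<and> (ys \<noteq> [] \<longrightarrow> hd ys = v) \<and>
      (\<forall>y\<in>set ys. 0 < dist y \<and> dist y \<le> k) \<and> length ys = k \<and> lev v \<le> k + lev (xs ! j)"
    if "v \<in> pverts G" "dist v = k" for v k
    using that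
  proof (induction k arbitrary: v)
    case 0
    then have "v \<in> set xs" using dist(1) by auto
    then obtain j where "j < L" "v = xs ! j" by (auto simp: in_set_conv_nth L_def)
    then show ?case by (intro exI[of _ j] exI[of _ "[]"]) (auto simp: is_path_def)
  next
    case (Suc k)
    have up: "(up v, v) \<in> parcs G" "dist (up v) = k" "up v \<in> pverts G"
      using dist(2)[of v] Suc.prems arc_in_verts by auto
    from Suc.IH[OF up(3,2)] obtain j ys where ys:
      "j < L" "is_path ys" "ys = [] \<or> (last ys, xs ! j) \<in> parcs G"
      "ys = [] \<longrightarrow> up v = xs ! j" "ys \<noteq> [] \<longrightarrow> hd ys = up v"
      "\<forall>y\<in>set ys. 0 < dist y \<and> dist y \<le> k" "length ys = k" "lev (up v) \<le> k + lev (xs ! j)"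
      by blast
    have "is_path (v # ys)" using ys Suc.prems arc_sym[OF up(1)]
      by (auto simp: is_path_def successively_Cons)
    moreover have "lev v \<le> Suc k + lev (xs ! j)" using ys(8) lev(3)[OF up(1)] by simp
    ultimately show ?case using ys Suc.prems arc_sym[OF up(1)]
      by (intro exI[of _ j] exI[of _ "v # ys"]) auto
  qed
  have "lev v \<le> h" if v: "v \<in> pverts G" for v
  proof -
    obtain j ys where ys: "j < L" "is_path ys" "ys = [] \<or> (last ys, xs ! j) \<in> parcs G"
      "\<forall>y\<in>set ys. 0 < dist y" "length ys = dist v" "lev v \<le> dist v + lev (xs ! j)"
      using tail[OF v refl] by blast
    have disj: "set ys \<inter> set xs = {}" using ys(4) inV dist(1) by fastforce
    have split: "is_path (take (Suc j) xs)" "is_path (drop j xs)"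
      using xs(1) is_path_append[of "take (Suc j) xs" "drop (Suc j) xs"]
        is_path_append[of "take j xs" "drop j xs"] by auto
    have hds: "hd (rev (take (Suc j) xs)) = xs ! j" "hd (drop j xs) = xs ! j"
      using ys(1) by (simp_all add: L_def hd_rev take_Suc_conv_app_nth hd_drop_conv_nth)
    have "is_path (ys @ drop j xs)"
      using ys split hds disj set_drop_subset[of j xs] by (subst is_path_append) auto
    from longest[OF this] have 1: "dist v \<le> j" using ys by (simp add: L_def)
    have "is_path (ys @ rev (take (Suc j) xs))"
      using ys split hds disj set_take_subset[of "Suc j" xs]
      by (subst is_path_append, subst is_path_rev) auto
    from longest[OF this] have 2: "dist v + Suc j \<le> L" using ys by (simp add: L_def)
    show ?thesis
    proof (cases "j \<le> m")
      case True
      then show ?thesis using left[of "m - j"] 1 ys(6) m by simp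
    next
      case False
      then show ?thesis using right[of "j - Suc m"] 2 ys m by simp
    qed
  qed
  then show ?thesis using that cc lev by blast
qed

end

section \<open>Sweeping the holes through the graph in depth-first order\<close>

text \<open>
  The setting of the sweep: a spanning tree grown from the central edge, with levels \<open>lev\<close> counted
  from both of its ends and parents \<open>par\<close>. Letting \<open>c\<close> be the parent of \<open>c'\<close> makes this a single
  tree, although both ends have level 0. Thus \<open>c'\<close> has the smallest level among the vertices to be explored, and
  choosing a vertex of largest level explores the whole side of \<open>c\<close> before it.
\<close>
locale centred_graph = connected_pair_graph G for G :: "'a pair_pre_digraph" +
  fixes c c' :: 'a and lev :: "'a \<Rightarrow> nat" and par :: "'a \<Rightarrow> 'a" and h :: nat
  assumes central: "(c, c') \<in> parcs G"
    and lev_zero: "\<And>v. v \<in> pverts G \<Longrightarrow> lev v = 0 \<longleftrightarrow> v \<in> {c, c'}"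
    and par_arc: "\<And>v. v \<in> pverts G \<Longrightarrow> lev v > 0 \<Longrightarrow> (par v, v) \<in> parcs G"
    and par_lev: "\<And>v. v \<in> pverts G \<Longrightarrow> lev v > 0 \<Longrightarrow> lev v = Suc (lev (par v))"
    and par_central: "par c' = c"
    and lev_le: "\<And>v. v \<in> pverts G \<Longrightarrow> lev v \<le> h"
    and h_pos: "h > 0" and h_less: "h < card (pverts G)"
begin

lemma central_verts: "c \<in> pverts G" "c' \<in> pverts G" "c \<noteq> c'"
  using central arc_in_verts arc_neq by blast+

lemma lev_central: "lev c = 0" "lev c' = 0"
  using central_verts lev_zero by auto

lemma par_in: "v \<in> pverts G \<Longrightarrow> lev v > 0 \<Longrightarrow> par v \<in> pverts G"
  using par_arc arc_in_verts by blast

lemma par_adj: "v \<in> pverts G \<Longrightarrow> v \<noteq> c \<Longrightarrow> (par v, v) \<in> parcs G"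
  using par_arc lev_zero par_central central by (cases "lev v = 0") auto

text \<open>
  The vertices that the holes will enter.
\<close>
definition inner :: "'a set" where
  "inner = {v \<in> pverts G. lev v < h}"

text \<open>
  A set that contains, with each vertex, its ancestors on the same side of the central edge. Such a
  set is automatically connected, even if it contains both or only one of \<open>c\<close> and \<open>c'\<close>.
\<close>
definition up_closed :: "'a set \<Rightarrow> bool" where
  "up_closed A \<longleftrightarrow> A \<subseteq> pverts G \<and> (\<forall>v\<in>A. lev v > 0 \<longrightarrow> par v \<in> A)"

definition frontier :: "'a set \<Rightarrow> 'a set" where
  "frontier A = {y \<in> inner - A. par y \<in> A}"

text \<open>
  The iteration stops at level 0, so that \<open>c\<close> does not count as an ancestor of the vertices on the
  side of \<open>c'\<close>: the holes may leave the side of \<open>c\<close> altogether after \<open>c'\<close> has been entered.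
\<close>
definition ancestors :: "'a \<Rightarrow> 'a set" where
  "ancestors v = (\<lambda>i. (par ^^ i) v) ` {..lev v}"

text \<open>
  The invariant of the depth-first search: \<open>A\<close> is the explored set and \<open>K\<close> the current set of
  holes. The last condition says that the vertices with inner children still to be explored form
  a chain in the tree, which is what distinguishes depth-first search from other searches and what allows \<open>K\<close> to
  abandon everything outside one branch.
\<close>
definition sweeping :: "'a set \<Rightarrow> 'a set \<Rightarrow> bool" where
  "sweeping A K \<longleftrightarrow> A \<subseteq> inner \<and> up_closed A \<and> c \<in> A \<and> K \<subseteq> A \<and> up_closed K \<and>
     par ` frontier A \<subseteq> K \<and>
     (\<forall>y\<in>frontier A. \<forall>z\<in>frontier A. lev y \<le> lev z \<longrightarrow> par y \<in> ancestors (par z))"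

lemma finite_inner: "finite inner"
  using pair_finite_verts by (simp add: inner_def)

lemma ancestors_self: "v \<in> ancestors v"
  unfolding ancestors_def by (rule image_eqI[of _ _ 0]) auto

lemma ancestors_step:
  assumes "v \<in> pverts G" "lev v > 0"
  shows "ancestors v = insert v (ancestors (par v))"
proof -
  have "{..lev v} = insert 0 (Suc ` {..lev (par v)})"
    using par_lev[OF assms] by (metis atMost_Suc_eq_insert_0)
  then show ?thesis by (simp add: ancestors_def image_image funpow_swap1)
qed

lemma ancestors_closed:
  assumes "v \<in> pverts G" "w \<in> ancestors v" "lev w > 0"
  shows "par w \<in> ancestors v"
  using assms
proof (induction "lev v" arbitrary: v)
  case 0
  then show ?case by (auto simp: ancestors_def)
next
  case (Suc k)
  then have v: "ancestors v = insert v (ancestors (par v))" using ancestors_step by simp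
  show ?case
  proof (cases "w = v")
    case True
    then show ?thesis using v ancestors_self by simp
  next
    case False
    then show ?thesis using v Suc par_in[of v] par_lev[of v] by auto
  qed
qed

lemma card_ancestors: "card (ancestors v) \<le> Suc (lev v)"
  unfolding ancestors_def by (metis card_atMost card_image_le finite_atMost)

text \<open>
  From any vertex one can climb inside \<open>K\<close> to \<open>c\<close> or \<open>c'\<close>. If two vertices climb to different
  ends, then both ends are in \<open>K\<close> and are joined by the central edge.
\<close>
lemma up_closed_connected:
  assumes K: "up_closed K" and "u \<in> K" "v \<in> K"
  shows "(u, v) \<in> (Restr (parcs G) K)\<^sup>*"
proof -
  let ?R = "Restr (parcs G) K"
  have "sym ?R" using arc_sym by (auto simp: sym_def)
  then have sym: "(b, a) \<in> ?R\<^sup>*" if "(a, b) \<in> ?R\<^sup>*" for a b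
    using that by (metis sym_rtrancl symD)
  have root: "\<exists>w\<in>{c, c'} \<inter> K. (w, v) \<in> ?R\<^sup>*" if "v \<in> K" for v
    using that
  proof (induction "lev v" arbitrary: v)
    case 0
    then have "v \<in> {c, c'}" using lev_zero K by (auto simp: up_closed_def)
    then show ?case using 0 by blast
  next
    case (Suc k)
    then have v: "v \<in> pverts G" "par v \<in> K" using K by (auto simp: up_closed_def)
    then have "(par v, v) \<in> ?R" "k = lev (par v)"
      using par_arc par_lev[of v] Suc by auto
    then show ?case using Suc.hyps(1)[of "par v"] v(2) by (meson rtrancl.rtrancl_into_rtrancl)
  qed
  obtain a b where ab: "a \<in> {c, c'} \<inter> K" "b \<in> {c, c'} \<inter> K" "(a, u) \<in> ?R\<^sup>*" "(b, v) \<in> ?R\<^sup>*"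
    using root assms(2,3) by metis
  have "(a, b) \<in> ?R\<^sup>*" using ab(1,2) central arc_sym by auto
  then show ?thesis using ab sym by (meson rtrancl_trans)
qed

lemma frontier_nonempty:
  assumes "up_closed A" "A \<subseteq> inner" "c \<in> A" "A \<noteq> inner"
  shows "frontier A \<noteq> {}"
proof -
  have "inner - A \<noteq> {}" using assms by blast
  then obtain v where v: "v \<in> inner - A" "\<And>w. w \<in> inner - A \<Longrightarrow> lev v \<le> lev w"
    using ex_has_least_nat[of "\<lambda>v. v \<in> inner - A" _ lev] by blast
  have "par v \<in> A"
  proof (cases "lev v = 0")
    case True
    then have "v = c'" using v assms lev_zero by (auto simp: inner_def)
    then show ?thesis using par_central assms by simp
  next
    case False
    then have "par v \<in> inner" "lev (par v) < lev v"
      using v par_lev[of v] par_in[of v] by (auto simp: inner_def)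
    then show ?thesis using v(2)[of "par v"] by fastforce
  qed
  then show ?thesis using v by (auto simp: frontier_def)
qed

text \<open>
  The new vertex \<open>y\<close> is a frontier vertex of largest level. Its children are deeper than the rest
  of the frontier, hence the chain condition survives. The set \<open>Q\<close> of the proper ancestors of \<open>y\<close>
  on its side contains all other vertices that still have inner children to be explored, and it has
  fewer than \<open>h\<close> elements. So \<open>K\<close> contains vertices outside \<open>Q\<close>, and giving up one of largest level
  keeps the set closed. The version without removal serves both to build the initial set of holes and
  to describe the corridor used by the displaced token.
\<close>
lemma sweeping_step:
  assumes AK: "sweeping A K" and "A \<noteq> inner"
  obtains y where "y \<in> frontier A" "sweeping (insert y A) (insert y K)"
    "card K = h \<Longrightarrow> \<exists>x\<in>K. sweeping (insert y A) (insert y K - {x})"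
proof -
  have A: "A \<subseteq> inner" "up_closed A" "c \<in> A" "K \<subseteq> A" "up_closed K" "par ` frontier A \<subseteq> K"
    and chain: "\<And>y z. y \<in> frontier A \<Longrightarrow> z \<in> frontier A \<Longrightarrow> lev y \<le> lev z \<Longrightarrow> par y \<in> ancestors (par z)"
    using AK by (auto simp: sweeping_def)
  have fin: "finite (frontier A)" using finite_inner by (simp add: frontier_def)
  have "Max (lev ` frontier A) \<in> lev ` frontier A"
    using fin frontier_nonempty A assms(2) by (intro Max_in) auto
  then obtain y where y: "y \<in> frontier A" and "lev y = Max (lev ` frontier A)" by force
  then have top: "\<And>z. z \<in> frontier A \<Longrightarrow> lev z \<le> lev y" using fin by simp
  have yV: "y \<in> pverts G" "y \<in> inner" "y \<notin> A" "par y \<in> K" "par y \<in> A" "y \<noteq> c"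
    using y A by (auto simp: frontier_def inner_def)
  \<comment> \<open>If \<open>y\<close> is \<open>c'\<close>, then the other side is finished and even \<open>c\<close> may be given up.\<close>
  define Q where "Q = (if lev y = 0 then {} else ancestors (par y))"
  have fr: "z \<in> frontier A \<or> (par z = y \<and> lev z = Suc (lev y))"
    if "z \<in> frontier (insert y A)" for z
  proof (cases "par z = y")
    case True
    then have "z \<in> pverts G" "z \<noteq> c" "z \<noteq> c'"
      using that A(3) yV par_central by (auto simp: frontier_def inner_def)
    then have "lev z > 0" using lev_zero by auto
    then show ?thesis using True par_lev \<open>z \<in> pverts G\<close> by auto
  next
    case False
    then show ?thesis using that by (auto simp: frontier_def)
  qed
  have old: "par z \<in> Q" if "z \<in> frontier (insert y A)" "par z \<noteq> y" for z
  proof -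
    have z: "z \<in> frontier A" "z \<noteq> y" using that fr by (auto simp: frontier_def)
    then have "lev y \<noteq> 0"
      using top[OF z(1)] yV(1,6) lev_zero lev_central A(3) by (auto simp: frontier_def inner_def)
    then show ?thesis using chain[OF z(1) y] top[OF z(1)] by (simp add: Q_def)
  qed
  have anc_y: "Q \<subseteq> ancestors y"
    using ancestors_step[OF yV(1)] by (auto simp: Q_def)
  have chain': "par z \<in> ancestors (par w)"
    if zw: "z \<in> frontier (insert y A)" "w \<in> frontier (insert y A)" "lev z \<le> lev w" for z w
  proof (cases "par w = y")
    case True
    then show ?thesis using old[OF zw(1)] anc_y ancestors_self[of y] by (cases "par z = y") auto
  next
    case False
    then have w: "w \<in> frontier A" using fr zw(2) by blast
    then have "z \<in> frontier A" using fr[OF zw(1)] zw(3) top[OF w] by auto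
    then show ?thesis using chain w zw(3) by blast
  qed
  have A': "insert y A \<subseteq> inner" "up_closed (insert y A)" "c \<in> insert y A"
    using A yV by (auto simp: up_closed_def)
  have K': "insert y K \<subseteq> insert y A" "up_closed (insert y K)"
    using A yV by (auto simp: up_closed_def)
  have fK: "par ` frontier (insert y A) \<subseteq> insert y K" using A(6) fr by blast
  have 1: "sweeping (insert y A) (insert y K)"
    unfolding sweeping_def using A' K' fK chain' by blast
  have 2: "\<exists>x\<in>K. sweeping (insert y A) (insert y K - {x})" if "card K = h"
  proof -
    have "card Q < h"
    proof (cases "lev y = 0")
      case False
      then show ?thesis
        using card_ancestors[of "par y"] par_lev[OF yV(1)] yV(2) by (auto simp: Q_def inner_def)
    qed (use h_pos in \<open>simp add: Q_def\<close>)
    moreover have finK: "finite K" using that h_pos card.infinite by force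
    moreover have finQ: "finite Q" by (simp add: Q_def ancestors_def)
    ultimately have "K - Q \<noteq> {}" using that by (metis Diff_eq_empty_iff card_mono leD)
    then have "Max (lev ` (K - Q)) \<in> lev ` (K - Q)" using finK by (intro Max_in) auto
    then obtain x where x: "x \<in> K - Q" and "lev x = Max (lev ` (K - Q))" by force
    then have low: "\<And>w. w \<in> K - Q \<Longrightarrow> lev w \<le> lev x" using finK by simp
    have xy: "x \<noteq> y" using x A(4) yV by blast
    have "up_closed (insert y K - {x})"
      unfolding up_closed_def
    proof (intro conjI ballI impI)
      show "insert y K - {x} \<subseteq> pverts G" using K'(2) by (auto simp: up_closed_def)
    next
      fix v assume v: "v \<in> insert y K - {x}" "0 < lev v"
      have vG: "v \<in> pverts G" using v K'(2) by (auto simp: up_closed_def)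
      have "par v \<noteq> x"
      proof
        assume px: "par v = x"
        show False
        proof (cases "v = y \<or> v \<in> Q")
          case True
          then have "lev y > 0" using v by (auto simp: Q_def split: if_splits)
          then have "par v \<in> Q"
            using True v ancestors_self[of "par y"]
              ancestors_closed[OF par_in[OF yV(1)], of v] by (auto simp: Q_def)
          then show False using px x by simp
        next
          case False
          then have "lev v \<le> lev x" using low v by blast
          then show False using par_lev[OF vG v(2)] px by simp
        qed
      qed
      then show "par v \<in> insert y K - {x}" using v K'(2) by (auto simp: up_closed_def)
    qed
    moreover have "par ` frontier (insert y A) \<subseteq> insert y K - {x}"
      using fK old x xy by auto
    ultimately have "sweeping (insert y A) (insert y K - {x})"
      unfolding sweeping_def using A' K'(1) chain' by blast
    then show ?thesis using x by blast
  qed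
  show thesis using that y 1 2 by blast
qed

text \<open>
  A vertex of level \<open>h\<close> has an ancestor on each smaller level, and without such a vertex all
  vertices are inner.
\<close>
lemma card_inner: "h \<le> card inner"
proof (cases "\<exists>v\<in>pverts G. lev v = h")
  case True
  then obtain v where v: "v \<in> pverts G" "lev v = h" by blast
  have "k \<in> lev ` pverts G" if "k \<le> lev v" "v \<in> pverts G" for k v
    using that
  proof (induction "lev v" arbitrary: v)
    case 0
    then show ?case by auto
  next
    case (Suc m)
    then show ?case using par_lev[of v] par_in[of v]
      by (metis image_eqI le_SucE zero_less_Suc old.nat.inject)
  qed
  then have "{..<h} \<subseteq> lev ` inner" using v unfolding inner_def
    by (smt (verit, best) image_iff lessThan_iff mem_Collect_eq nat_less_le subsetI)
  then show ?thesis using finite_inner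
    by (metis card_image_le card_lessThan card_mono finite_imageI le_trans)
next
  case False
  then have "inner = pverts G" using lev_le by (force simp: inner_def)
  then show ?thesis using h_less by simp
qed

lemma sweeping_start:
  obtains A where "card A = h" "sweeping A A"
proof -
  have "\<exists>A. card A = Suc k \<and> sweeping A A" if "Suc k \<le> h" for k
    using that
  proof (induction k)
    case 0
    have "lev y \<le> 1" if "y \<in> frontier {c}" for y
      using that par_lev[of y] lev_central by (cases "lev y = 0") (auto simp: frontier_def inner_def)
    then have "sweeping {c} {c}"
      using central_verts lev_central h_pos ancestors_self
      by (auto simp: sweeping_def up_closed_def inner_def frontier_def)
    then show ?case by (intro exI[of _ "{c}"]) simp
  next
    case (Suc k)
    then obtain A where A: "card A = Suc k" "sweeping A A" by auto
    then have "A \<noteq> inner" using Suc.prems card_inner by auto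
    then obtain y where "y \<in> frontier A" "sweeping (insert y A) (insert y A)"
      using sweeping_step A by blast
    moreover have "finite A" using A(1) card.infinite by fastforce
    ultimately show ?case using A(1)
      by (intro exI[of _ "insert y A"]) (auto simp: frontier_def)
  qed
  from this[of "h - 1"] show thesis using that h_pos by auto
qed

text \<open>
  Token \<open>i\<close> enters the connected set \<open>F\<close> and glides to the neighbour \<open>w\<close> of token \<open>j\<close>. Its own
  vertex may belong to \<open>F\<close>; this covers the token that is about to be displaced.
\<close>
lemma can_meet_if_adjacent:
  assumes p: "placement G r p0" "(slide G r)\<^sup>*\<^sup>* p0 p" and ij: "i < r" "i \<noteq> j"
    and F: "up_closed F" "F \<subseteq> insert (p i) (holes G r p)"
    and u: "u \<in> F" "p i = u \<or> (u, p i) \<in> parcs G" and w: "w \<in> F" "(w, p j) \<in> parcs G"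
  shows "can_meet r p0 i j"
proof -
  let ?R = "Restr (parcs G) (insert (p i) (holes G r p))"
  have "(u, w) \<in> ?R\<^sup>*"
    using up_closed_connected[OF F(1) u(1) w(1)] F(2)
    by (meson Int_mono Sigma_mono order_refl rtrancl_mono subsetD)
  moreover have "(p i, u) \<in> ?R\<^sup>*" using u F(2) arc_sym by auto
  ultimately show ?thesis using can_meet_by_glide[OF p ij _ w(2)] by (meson rtrancl_trans)
qed

section \<open>Listing the tokens along the sweep\<close>

text \<open>
  At the start all explored vertices are holes, and displaced tokens end on explored vertices, so the
  tokens on \<open>A\<close> are those that have been displaced. The other listed tokens
  stand outside the inner vertices and have been uncovered by the exploration of their parents.
\<close>
definition listed :: "nat \<Rightarrow> 'a set \<Rightarrow> (nat \<Rightarrow> 'a) \<Rightarrow> nat set" where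
  "listed r A p = {i. i < r \<and> (p i \<in> A \<or> p i \<notin> inner \<and> par (p i) \<in> A)}"

text \<open>
  The last condition lets the list be continued by whichever frontier token is displaced next. An
  empty list is possible at the beginning.
\<close>
definition progress ::
    "nat \<Rightarrow> (nat \<Rightarrow> 'a) \<Rightarrow> 'a set \<Rightarrow> (nat \<Rightarrow> 'a) \<Rightarrow> nat list \<Rightarrow> bool" where
  "progress r p0 A p zs \<longleftrightarrow> (slide G r)\<^sup>*\<^sup>* p0 p \<and> sweeping A (holes G r p) \<and>
     distinct zs \<and> set zs = listed r A p \<and> successively (can_meet r p0) zs \<and>
     (\<forall>j<r. zs \<noteq> [] \<and> p j \<in> frontier A \<longrightarrow> can_meet r p0 (last zs) j)"

text \<open>
  The list grows by the displaced token \<open>i\<close> and by the tokens \<open>bs\<close> on the children of \<open>y\<close> outside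
  the inner vertices. While gliding through \<open>insert y K\<close>, token \<open>i\<close> can meet everything next to
  that set, in particular \<open>bs\<close> and the whole new frontier. After the move \<open>y\<close> is a hole, so the
  tokens \<open>bs\<close> can meet each other and the new frontier through the new set of holes.
\<close>
lemma progress_step:
  assumes p0: "placement G r p0" "card (holes G r p0) = h"
    and pr: "progress r p0 A p zs" and A: "A \<noteq> inner"
  obtains y p' zs' where "y \<in> inner - A" "progress r p0 (insert y A) p' zs'"
proof -
  define K where "K = holes G r p"
  have sl: "(slide G r)\<^sup>*\<^sup>* p0 p" and sw: "sweeping A K"
    and zs: "distinct zs" "set zs = listed r A p" "successively (can_meet r p0) zs"
    and lst: "\<And>j. j < r \<Longrightarrow> zs \<noteq> [] \<Longrightarrow> p j \<in> frontier A \<Longrightarrow> can_meet r p0 (last zs) j"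
    using pr by (auto simp: progress_def K_def)
  have p: "placement G r p" using slides_placement sl p0(1) by blast
  then have inj: "inj_on p {..<r}" and pV: "\<And>j. j < r \<Longrightarrow> p j \<in> pverts G"
    by (auto simp: placement_def)
  have cardK: "card K = h"
  proof -
    have "card (holes G r q) = card (pverts G) - r" if "placement G r q" for q
      using that unfolding holes_def placement_def
      by (simp add: card_Diff_subset card_image)
    then show ?thesis using p p0 K_def by metis
  qed
  obtain y x where y: "y \<in> frontier A" and swF: "sweeping (insert y A) (insert y K)"
    and x: "x \<in> K" and swK: "sweeping (insert y A) (insert y K - {x})"
    using sweeping_step[OF sw A] cardK by metis
  have AK: "A \<subseteq> inner" "K \<subseteq> A" "c \<in> A" "par ` frontier A \<subseteq> K" using sw by (auto simp: sweeping_def)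
  have yA: "y \<notin> A" "y \<in> inner" "y \<in> pverts G" using y by (auto simp: frontier_def inner_def)
  then obtain i where i: "i < r" "p i = y"
    using AK(2) unfolding K_def holes_def by fastforce
  define p' where "p' = p(i := x)"
  have oth: "p j \<noteq> y" if "j < r" "j \<noteq> i" for j
    using that i inj by (auto simp: inj_on_def)
  have xy: "x \<noteq> y" using x AK yA by blast
  have holes': "holes G r p' = insert y K - {x}"
    using placement_update(2)[OF p i(1), of x] x i(2) by (simp add: p'_def K_def)
  have upF: "up_closed (insert y K)" and upK: "up_closed (insert y K - {x})"
    using swF swK by (auto simp: sweeping_def)
  have sl': "(slide G r)\<^sup>*\<^sup>* p0 p'"
  proof -
    have "(p i, x) \<in> (Restr (parcs G) (insert (p i) (holes G r p)))\<^sup>*"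
      using up_closed_connected[OF upF, of y x] x i(2) K_def by simp
    then show ?thesis using glide[OF p i(1)] sl by (metis p'_def rtranclp_trans)
  qed
  define B where "B = {j. j < r \<and> p j \<notin> inner \<and> par (p j) = y}"
  define bs where "bs = sorted_list_of_set B"
  have bs: "distinct bs" "set bs = B" by (simp_all add: bs_def B_def)
  have B: "j < r" "j \<noteq> i" "p' j = p j" "(y, p j) \<in> parcs G" "j \<notin> listed r A p" if "j \<in> B" for j
  proof -
    have j: "j < r" "p j \<notin> inner" "par (p j) = y" using that by (auto simp: B_def)
    then show "j < r" "j \<noteq> i" using i yA by auto
    then show "p' j = p j" by (simp add: p'_def)
    have "p j \<noteq> c" using j AK by auto
    then show "(y, p j) \<in> parcs G" using par_adj[OF pV] j by metis
    show "j \<notin> listed r A p" using j yA AK by (auto simp: listed_def)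
  qed
  have mover: "can_meet r p0 i j" if "i \<noteq> j" "w \<in> insert y K" "(w, p j) \<in> parcs G" for j w
    by (rule can_meet_if_adjacent[OF p0(1) sl i(1) that(1) upF _ _ _ that(2,3), of y])
       (use i K_def in auto)
  have child: "can_meet r p0 j k" if "j \<in> B" "j \<noteq> k" "w \<in> insert y K - {x}" "(w, p' k) \<in> parcs G" for j k w
    by (rule can_meet_if_adjacent[OF p0(1) sl' B(1)[OF that(1)] that(2) upK _ _ _ that(3,4), of y])
       (use holes' xy B[OF that(1)] in auto)
  have i_new: "i \<notin> listed r A p" using i yA by (auto simp: listed_def)
  define zs' where "zs' = zs @ i # bs"
  have "distinct zs'"
    unfolding zs'_def using zs bs B i_new by auto
  moreover have "set zs' = listed r (insert y A) p'"
  proof -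
    have "j \<in> listed r (insert y A) p' \<longleftrightarrow> j \<in> listed r A p \<or> j = i \<or> j \<in> B" for j
      using i x AK yA oth[of j] by (auto simp: listed_def B_def p'_def)
    then show ?thesis using zs bs by (auto simp: zs'_def)
  qed
  moreover have "successively (can_meet r p0) zs'"
  proof -
    have "can_meet r p0 j k" if "j \<in> B" "k \<in> B" "j \<noteq> k" for j k
      using child[OF that(1,3), of y] B(3,4)[OF that(2)] xy by simp
    then have "successively (can_meet r p0) bs"
      using bs by (intro successively_if_pairwise) auto
    moreover have "can_meet r p0 i (hd bs)" if "bs \<noteq> []"
      using that bs B[of "hd bs"] mover[of "hd bs" y] by auto
    ultimately show ?thesis using zs(3) lst[OF i(1)] y i(2)
      by (auto simp: zs'_def successively_append_iff successively_Cons)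
  qed
  moreover have "can_meet r p0 (last zs') j" if j: "j < r" "p' j \<in> frontier (insert y A)" for j
  proof -
    have ji: "j \<noteq> i" using j x AK by (auto simp: p'_def frontier_def)
    then have pj: "p' j = p j" by (simp add: p'_def)
    have "p j \<noteq> c" using AK(3) j pj by (auto simp: frontier_def)
    then have adj: "(par (p j), p j) \<in> parcs G" using par_adj pV j by blast
    have par: "par (p j) \<in> insert y K - {x}" using swK j pj by (auto simp: sweeping_def)
    show ?thesis
    proof (cases "bs = []")
      case True
      then show ?thesis using mover[OF ji[symmetric] _ adj] par by (simp add: zs'_def)
    next
      case False
      then have l: "last bs \<in> B" using bs by auto
      have "last bs \<noteq> j" using l j pj by (auto simp: B_def frontier_def)
      then show ?thesis using child[OF l _ par] adj pj False by (simp add: zs'_def)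
    qed
  qed
  ultimately have "progress r p0 (insert y A) p' zs'"
    unfolding progress_def using sl' swK holes' by auto
  then show thesis using that yA by blast
qed

lemma progress_complete:
  assumes "placement G r p0" "card (holes G r p0) = h" "progress r p0 A p zs"
  shows "\<exists>xs. distinct xs \<and> set xs = {..<r} \<and> successively (can_meet r p0) xs"
  using assms(3)
proof (induction "card (inner - A)" arbitrary: A p zs rule: less_induct)
  case less
  show ?case
  proof (cases "A = inner")
    case True
    have sl: "(slide G r)\<^sup>*\<^sup>* p0 p" and up: "c \<in> inner"
      and zs: "distinct zs" "set zs = listed r inner p" "successively (can_meet r p0) zs"
      using less.prems True by (auto simp: progress_def sweeping_def)
    have "i \<in> listed r inner p" if "i < r" for i
    proof -
      have v: "p i \<in> pverts G"
        using slides_placement[OF sl assms(1)] that by (auto simp: placement_def)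
      then show ?thesis
        using that lev_le[OF v] h_pos par_lev[OF v] par_in[OF v]
        unfolding listed_def inner_def by (cases "lev (p i) < h") auto
    qed
    then have "set zs = {..<r}" using zs(2) by (auto simp: listed_def)
    then show ?thesis using zs by blast
  next
    case False
    obtain y p' zs' where y: "y \<in> inner - A" "progress r p0 (insert y A) p' zs'"
      using progress_step[OF assms(1,2) less.prems False] .
    have "card (inner - insert y A) < card (inner - A)"
      using y(1) finite_inner by (intro psubset_card_mono) auto
    then show ?thesis using less.hyps y(2) by blast
  qed
qed

text \<open>
  Initially no token has been displaced, and the listed tokens, all next to the initial set of
  holes, can be taken in any order.
\<close>
lemma meeting_list:
  assumes r: "r = card (pverts G) - h"
  obtains p xs where "placement G r p" "card (holes G r p) = h"
    "distinct xs" "set xs = {..<r}" "successively (can_meet r p) xs"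
proof -
  obtain A where A: "card A = h" "sweeping A A" using sweeping_start .
  have AV: "A \<subseteq> pverts G" "c \<in> A" "up_closed A" using A by (auto simp: sweeping_def up_closed_def)
  have "card (pverts G - A) = r" using A AV r by (simp add: card_Diff_subset finite_subset pair_finite_verts)
  then obtain p where p: "bij_betw p {..<r} (pverts G - A)"
    by (metis card_lessThan finite_Diff finite_lessThan finite_same_card_bij pair_finite_verts)
  have pl: "placement G r p" and ho: "holes G r p = A"
    using p AV by (auto simp: placement_def holes_def bij_betw_def)
  define zs where "zs = sorted_list_of_set (listed r A p)"
  have zs: "distinct zs" "set zs = listed r A p" by (simp_all add: zs_def listed_def)
  have adj: "j < r \<and> par (p j) \<in> A \<and> (par (p j), p j) \<in> parcs G" if "j \<in> listed r A p \<or> j < r \<and> p j \<in> frontier A" for j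
  proof -
    have "j < r" "p j \<in> pverts G" "p j \<notin> A" "par (p j) \<in> A"
      using that p by (auto simp: listed_def bij_betw_def frontier_def)
    then show ?thesis using par_adj AV(2) by metis
  qed
  have meet: "can_meet r p i j"
    if "i \<in> listed r A p" "j \<in> listed r A p \<or> j < r \<and> p j \<in> frontier A" "i \<noteq> j" for i j
    by (rule can_meet_if_adjacent[OF pl rtranclp.rtrancl_refl, of i j A "par (p i)" "par (p j)"])
       (use adj[of i] adj[of j] that ho AV in auto)
  have "can_meet r p (last zs) j" if "j < r" "zs \<noteq> []" "p j \<in> frontier A" for j
  proof -
    have "last zs \<in> listed r A p" using last_in_set[OF that(2)] zs(2) by simp
    moreover have "j \<notin> listed r A p" using that by (auto simp: listed_def frontier_def)
    ultimately show ?thesis using meet[of "last zs" j] that by metis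
  qed
  then have "progress r p A p zs"
    unfolding progress_def using zs meet ho A by (auto intro: successively_if_pairwise)
  then show thesis using progress_complete[OF pl] ho A that pl by metis
qed

end

section \<open>The closed schedule\<close>

theorem theorem2p3:
  fixes T :: "'a pair_pre_digraph" and n :: nat
  assumes "tree_graph T" and "card (pverts T) = n" and "n \<ge> 1"
  shows "\<exists>p. placement T (token_number n) p \<and>
             card (holes T (token_number n) p) = hole_number n \<and>
             (\<exists>ps xs. closed_schedule T (token_number n) ps \<and> hd ps = p \<and>
                hamilton_path (contact_graph T (token_number n) ps) xs)"
proof -
  interpret connected_pair_graph T
    using assms(1) by (simp add: tree_graph_def connected_pair_graph_def connected_pair_graph_axioms_def)
  define h where "h = hole_number n"
  define r where "r = token_number n"
  have h: "n \<le> 3 * h + 3" "h < n" and r: "r = n - h" "r > 0"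
    using assms(3) by (auto simp: h_def r_def hole_number_def token_number_def)
  have suff: ?thesis if "placement T r p" "card (holes T r p) = h"
      "distinct xs" "set xs = {..<r}" "successively (can_meet r p) xs" for p xs
  proof -
    have "0 \<in> set xs" unfolding that(4) using r(2) by simp
    then have "xs \<noteq> []" by (metis list.set(1) empty_iff)
    from closed_schedule_of_meetings[OF that(1,3,4) this that(5)]
    obtain ps where "closed_schedule T r ps" "hd ps = p" "hamilton_path (contact_graph T r ps) xs"
      by blast
    then show ?thesis
      unfolding h_def[symmetric] r_def[symmetric] using that(1,2)
      by (intro exI[of _ p] conjI exI[of _ ps] exI[of _ xs])
  qed
  have bound: "length xs < Suc n" if "is_path xs" for xs
    using that assms(2) pair_finite_verts card_mono[of "pverts T" "set xs"]
    by (auto simp: is_path_def distinct_card)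
  have "is_path []" by (simp add: is_path_def)
  then obtain xs where xs: "is_path xs" and longest: "\<And>ys. is_path ys \<Longrightarrow> length ys \<le> length xs"
    using ex_has_greatest_nat[of is_path "[]" length "Suc n"] bound by (metis less_imp_le)
  \<comment> \<open>Either a longest path has room for all tokens, or it is short and yields a central edge.\<close>
  show ?thesis
  proof (cases "r \<le> length xs")
    case True
    define p where "p = (!) xs"
    have p: "placement T r p" using xs True
      by (auto simp: p_def placement_def is_path_def inj_on_def nth_eq_iff_index_eq)
    then have "card (holes T r p) = h"
      using r h assms(2) unfolding holes_def placement_def
      by (simp add: card_Diff_subset card_image)
    moreover have "successively (can_meet r p) [0..<r]"
    proof -
      have "can_meet r p i (Suc i)" if "Suc i < r" for i
      proof -
        have "(xs ! i, xs ! Suc i) \<in> parcs T"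
          using xs True that successively_nth[of "\<lambda>u v. (u, v) \<in> parcs T" xs i] by (simp add: is_path_def)
        then show ?thesis unfolding can_meet_def contact_def p_def
          by (intro exI[of _ "(!) xs"]) simp
      qed
      then show ?thesis by (simp add: successively_conv_nth)
    qed
    ultimately show ?thesis using suff[OF p, of "[0..<r]"] by (simp add: atLeast0LessThan)
  next
    case False
    obtain v where v: "v \<in> pverts T" using verts_nonempty by blast
    have "pverts T \<noteq> {v}" using False longest[of "[v]"] v r h assms(2) by (auto simp: is_path_def)
    then obtain u where u: "u \<in> pverts T" "u \<noteq> v" using v by blast
    obtain w where "(v, w) \<in> parcs T"
      using verts_connected[OF v u(1)] u(2) by (metis converse_rtranclE)
    then have "is_path [v, w]" using arc_in_verts arc_neq by (auto simp: is_path_def)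
    from longest[OF this] have len: "2 \<le> length xs" by simp
    have "length xs \<le> 2 * h + 2" using False r h by simp
    then obtain c c' and lev :: "'a \<Rightarrow> nat" and par where ce: "(c, c') \<in> parcs T"
      "\<And>v. v \<in> pverts T \<Longrightarrow> lev v = 0 \<longleftrightarrow> v \<in> {c, c'}"
      "\<And>v. v \<in> pverts T \<Longrightarrow> lev v > 0 \<Longrightarrow> (par v, v) \<in> parcs T \<and> lev v = Suc (lev (par v))"
      "\<And>v. v \<in> pverts T \<Longrightarrow> lev v \<le> h"
      using central_edge[OF xs len _ longest, of h] by metis
    \<comment> \<open>Without holes, all vertices would be ends of the central edge, and the longest path, having
       at least two vertices, would have room for all tokens.\<close>
    have "h > 0"
    proof (rule ccontr)
      assume "\<not> h > 0"
      then have "pverts T \<subseteq> {c, c'}" using ce(2,4) by auto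
      then have "n \<le> card {c, c'}" using assms(2) card_mono by (metis finite.emptyI finite_insert)
      then have "n \<le> 2" using card_insert_le_m1[of 2 "{c'}" c] by simp
      then show False using False len r by simp
    qed
    have lev0: "lev c' = 0" using ce(1,2) arc_in_verts by blast
    interpret centred_graph T c c' lev "par(c' := c)" h
      by unfold_locales (use ce lev0 \<open>h > 0\<close> h assms(2) in \<open>auto split: if_splits\<close>)
    show ?thesis using meeting_list[of r] suff r assms(2) by metis
  qed
qed

end
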